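(* Let $q$ be a prime power. In ${\rm PG}(7,q)$ let $U_i$ be the point with $1$ in position $i$ and $0$ elsewhere, let $\Sigma=\langle U_5,U_6,U_7,U_8\rangle$ and $\Sigma'=\langle U_1,U_2,U_3,U_4\rangle$. Let $\mathcal A$ be a $(4\times4,2)_q$ MRD--code and $\mathcal X=\{L(A)\mid A\in\mathcal A\}$ (a set of $q^{12}$ solids). Let $\mathcal P$ be a $1$--parallelism of $\Sigma$, $\mathcal P'$ a $1$--parallelism of $\Sigma'$, and $\mu:\mathcal P'\to\mathcal P$ a bijection. For a line $\ell'$ of $\Sigma'$, let $\mathcal S'_{\ell'}$ be the unique line--spread of $\mathcal P'$ containing $\ell'$, let $\Gamma_{\ell'}=\langle\Sigma,\ell'\rangle$, and let $\mathcal Z_{\ell'}$ be the set of all solids of $\Gamma_{\ell'}$ (different from $\Sigma$) meeting $\Sigma$ exactly in a line belonging to the spread $\mu(\mathcal S'_{\ell'})$ (so $|\mathcal Z_{\ell'}|=q^4(q^2+1)$). Let $\mathcal Z=\bigcup_{\ell'}\mathcal Z_{\ell'}$, the union over all lines $\ell'$ of $\Sigma'$. Then $\mathcal X\cup\mathcal Z\cup\{\Sigma\}$ is a $q$--covering design $\mathbb{C}_q(8,4,3)$ (every plane of ${\rm PG}(7,q)$ is contained in at least one of its solids) of size $q^{12}+q^4(q^2+1)^2(q^2+q+1)+1$.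
   Context: A solid is a 3--dimensional projective subspace. A $(4\times4,2)_q$ MRD--code is a set of $q^{12}$ matrices in $\mathcal M_{4\times4}({\rm GF}(q))$ with $\mathrm{rank}(A-B)\ge2$ for all distinct $A,B$ in it. For a $4\times4$ matrix $A$, $L(A)$ is the solid of ${\rm PG}(7,q)$ spanned by the points whose coordinate vectors are the rows of $(I_4\,|\,A)$. A line--spread of ${\rm PG}(3,q)$ is a set of $q^2+1$ lines partitioning its points; a $1$--parallelism of ${\rm PG}(3,q)$ is a set of $q^2+q+1$ line--spreads such that every line of ${\rm PG}(3,q)$ lies in exactly one of them. A $q$--covering design $\mathbb{C}_q(n,k,r)$ is a collection of $(k-1)$--dimensional subspaces of ${\rm PG}(n-1,q)$ such that every $(r-1)$--dimensional subspace is contained in at least one of them. *)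

theory Defs
  imports "HOL-Analysis.Analysis"
begin

text \<open>
  \<open>PG(n-1,q)\<close> is the projective space of the vector space \<open>'a^'n\<close> with \<open>n = CARD('n)\<close> and
  \<open>q = CARD('a)\<close>: its \<open>(k-1)\<close>-dimensional subspaces are the \<open>k\<close>-dimensional linear subspaces,
  incidence is inclusion, and the span of two subspaces is the linear span of their union.
  So \<open>flat k\<close> counts linear (vector space) dimension.
\<close>

definition flat :: "nat \<Rightarrow> ('a::field ^ 'n) set \<Rightarrow> bool" where
  "flat k W \<longleftrightarrow> vec.subspace W \<and> vec.dim W = k"

abbreviation point :: "('a::field ^ 'n) set \<Rightarrow> bool" where
  "point \<equiv> flat 1"

abbreviation line :: "('a::field ^ 'n) set \<Rightarrow> bool" where
  "line \<equiv> flat 2"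

abbreviation solid :: "('a::field ^ 'n) set \<Rightarrow> bool" where
  "solid \<equiv> flat 4"

definition q_covering_design :: "nat \<Rightarrow> nat \<Rightarrow> nat \<Rightarrow> ('a::{field,finite} ^ 'n) set set \<Rightarrow> bool" where
  "q_covering_design n k r C \<longleftrightarrow>
     CARD('n) = n \<and> (\<forall>W\<in>C. flat k W) \<and> (\<forall>V. flat r V \<longrightarrow> (\<exists>W\<in>C. V \<subseteq> W))"

text \<open>The set \<open>T\<close> is meant to be a solid, playing the role of \<open>PG(3,q)\<close>; this is not enforced here.\<close>

definition line_spread :: "('a::{field,finite} ^ 'n) set \<Rightarrow> ('a ^ 'n) set set \<Rightarrow> bool" where
  "line_spread T S \<longleftrightarrow>
     (\<forall>l\<in>S. line l \<and> l \<subseteq> T) \<and> card S = CARD('a)^2 + 1 \<and>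
     (\<forall>p. point p \<and> p \<subseteq> T \<longrightarrow> (\<exists>!l. l \<in> S \<and> p \<subseteq> l))"

definition one_parallelism :: "('a::{field,finite} ^ 'n) set \<Rightarrow> ('a ^ 'n) set set set \<Rightarrow> bool" where
  "one_parallelism T P \<longleftrightarrow>
     (\<forall>S\<in>P. line_spread T S) \<and> card P = CARD('a)^2 + CARD('a) + 1 \<and>
     (\<forall>l. line l \<and> l \<subseteq> T \<longrightarrow> (\<exists>!S. S \<in> P \<and> l \<in> S))"

definition mrd_code_4_4_2 :: "('a::{field,finite} ^ 4 ^ 4) set \<Rightarrow> bool" where
  "mrd_code_4_4_2 \<A> \<longleftrightarrow>
     card \<A> = CARD('a)^12 \<and> (\<forall>A\<in>\<A>. \<forall>B\<in>\<A>. A \<noteq> B \<longrightarrow> rank (A - B) \<ge> 2)"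

text \<open>
  \<open>PG(7,q)\<close> is taken on \<open>'a^(4+4)\<close>: the indices \<open>Inl i\<close> are the positions 1 to 4 and the
  indices \<open>Inr i\<close> are the positions 5 to 8. The vector \<open>axis k 1\<close> represents the point \<open>U\<^sub>k\<close>.
\<close>

definition Sigma_last :: "('a::field ^ (4 + 4)) set" where
  "Sigma_last = vec.span (range (\<lambda>i. axis (Inr i) 1))"

definition Sigma_first :: "('a::field ^ (4 + 4)) set" where
  "Sigma_first = vec.span (range (\<lambda>i. axis (Inl i) 1))"

definition identity_augmented :: "'a::field ^ 4 ^ 4 \<Rightarrow> 'a ^ (4 + 4) ^ 4" where
  "identity_augmented A = (\<chi> i k. case k of Inl j \<Rightarrow> mat 1 $ i $ j | Inr j \<Rightarrow> A $ i $ j)"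

definition lifted_solid :: "'a::field ^ 4 ^ 4 \<Rightarrow> ('a ^ (4 + 4)) set" where
  "lifted_solid A = vec.span (rows (identity_augmented A))"

definition Gamma_span :: "('a::field ^ (4 + 4)) set \<Rightarrow> ('a ^ (4 + 4)) set" where
  "Gamma_span l' = vec.span (Sigma_last \<union> l')"

definition spread_containing :: "('a::field ^ 'n) set set set \<Rightarrow> ('a ^ 'n) set \<Rightarrow> ('a ^ 'n) set set" where
  "spread_containing P l = (THE S. S \<in> P \<and> l \<in> S)"

definition Z_solids ::
  "('a::field ^ (4 + 4)) set set set \<Rightarrow> (('a ^ (4 + 4)) set set \<Rightarrow> ('a ^ (4 + 4)) set set) \<Rightarrow>
   ('a ^ (4 + 4)) set \<Rightarrow> ('a ^ (4 + 4)) set set" where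
  "Z_solids P' \<mu> l' =
     {W. solid W \<and> W \<subseteq> Gamma_span l' \<and> W \<noteq> Sigma_last \<and>
         W \<inter> Sigma_last \<in> \<mu> (spread_containing P' l')}"

end

theory Submission
  imports Defs
begin

text \<open>
  Project from \<open>\<Sigma>\<close> onto the first four coordinates: the dimension of a subspace is that of its
  trace on \<open>\<Sigma>\<close> plus that of its projection. A plane disjoint from \<open>\<Sigma>\<close> is the graph of a linear map on a
  three-dimensional space of row vectors, and the code restricts bijectively onto all such maps.
  If a plane \<open>V\<close> meets \<open>\<Sigma>\<close> in a point, its projection determines \<open>\<ell>'\<close>, and \<open>V\<close> is joined with the
  line through that point of the spread \<open>\<mu>(\<S>'\<^bsub>\<ell>'\<^esub>)\<close>. If it meets \<open>\<Sigma>\<close> in a line \<open>l\<close>, then \<open>\<mu>\<close> returns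
  from the spread containing \<open>l\<close> to a spread of \<open>\<Sigma>'\<close>, whose line through the projected point is
  \<open>\<ell>'\<close>. The traces on \<open>\<Sigma>\<close> have dimensions 0, 2 and 4 for \<open>\<X>\<close>, \<open>\<Z>\<close> and \<open>\<Sigma>\<close>, so the three families
  are disjoint, and \<open>\<ell>'\<close> is recovered from any member of \<open>\<Z>\<^bsub>\<ell>'\<^esub>\<close> by projecting it.
\<close>

section \<open>Linear algebra: complements, rank-nullity, number of vectors\<close>

text \<open>A basis \<open>B\<close> of \<open>U\<close> extends to a basis \<open>B'\<close> of
  \<open>W\<close>, and the added vectors span \<open>C\<close>. The dimension formula for sums then
  forces \<open>U\<close> and \<open>C\<close> to meet trivially.\<close>

lemma subspace_complement_exists:
  fixes U W :: "('a::field ^ 'n) set"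
  assumes U: "vec.subspace U" and W: "vec.subspace W" and UW: "U \<subseteq> W"
  obtains C where "vec.subspace C" "C \<subseteq> W" "U \<inter> C = {0}" "vec.dim U + vec.dim C = vec.dim W"
    "\<And>w. w \<in> W \<Longrightarrow> \<exists>u\<in>U. \<exists>c\<in>C. w = u + c"
proof -
  obtain B where B: "B \<subseteq> U" "vec.independent B" "U \<subseteq> vec.span B" "card B = vec.dim U"
    using vec.basis_exists by blast
  obtain B' where B': "B \<subseteq> B'" "B' \<subseteq> W" "vec.independent B'" "W \<subseteq> vec.span B'"
    using vec.maximal_independent_subset_extend[of B W] B UW by blast
  let ?C = "vec.span (B' - B)"
  have spU: "vec.span B = U"
    using B U by (simp add: vec.span_subspace)
  have spW: "vec.span B' = W"
    using B' W by (simp add: vec.span_subspace)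
  have fin: "finite B'"
    using B'(3) vec.finiteI_independent by blast
  have CW: "?C \<subseteq> W"
    using B'(2) W vec.span_minimal by (metis Diff_subset order_trans)
  have sums: "{x + y |x y. x \<in> U \<and> y \<in> ?C} = W"
    using vec.span_Un[of B "B' - B"] B'(1) by (simp add: spU spW Un_absorb1)
  have dC: "vec.dim ?C = card (B' - B)"
    using B'(3) vec.independent_mono vec.dim_span_eq_card_independent by blast
  have dW: "vec.dim W = card B'"
    using B'(3) spW vec.dim_span_eq_card_independent by blast
  have add: "vec.dim U + vec.dim ?C = vec.dim W"
    using B(4) dC dW fin B'(1) card_mono[OF fin B'(1)] finite_subset[OF B'(1) fin]
    by (simp add: card_Diff_subset)
  have "vec.dim (U \<inter> ?C) = 0"
    using vec.dim_sums_Int[OF U vec.subspace_span, of "B' - B"] sums add by simp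
  then have "U \<inter> ?C = {0}"
    using vec.subspace_0[OF U] vec.span_zero[of "B' - B"] by auto
  moreover have "\<exists>u\<in>U. \<exists>c\<in>?C. w = u + c" if "w \<in> W" for w
    using that sums by blast
  ultimately show thesis
    using that[of ?C] CW add by simp
qed

text \<open>On a complement in \<open>W\<close> of the kernel of \<open>f\<close>, the map is
  injective and has the same image as on \<open>W\<close>. This is rank-nullity relative to a
  subspace, as needed for projecting planes and solids.\<close>

lemma dim_kernel_plus_dim_image:
  fixes f :: "'a::field ^ 'n \<Rightarrow> 'a ^ 'm"
  assumes f: "Vector_Spaces.linear (*s) (*s) f" and W: "vec.subspace W"
  shows "vec.dim W = vec.dim {x \<in> W. f x = 0} + vec.dim (f ` W)"
proof -
  have lin: "f (x + y) = f x + f y" "f (x - y) = f x - f y" "f 0 = 0" for x y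
    using f by (simp_all add: vec.linear_add vec.linear_diff vec.linear_0)
  let ?K = "{x \<in> W. f x = 0}"
  have "?K = W \<inter> {x. f x = 0}"
    by blast
  then have K: "vec.subspace ?K"
    using W vec.linear_subspace_kernel[OF f] vec.subspace_inter by metis
  obtain C where C: "vec.subspace C" "C \<subseteq> W" "?K \<inter> C = {0}" "vec.dim ?K + vec.dim C = vec.dim W"
    "\<And>w. w \<in> W \<Longrightarrow> \<exists>u\<in>?K. \<exists>c\<in>C. w = u + c"
    using subspace_complement_exists[OF K W] by auto
  have "x = y" if "x \<in> C" "y \<in> C" "f x = f y" for x y
  proof -
    have "x - y \<in> ?K \<inter> C"
      using that C(1,2) vec.subspace_diff[OF C(1)] by (auto simp: lin)
    then show ?thesis
      using C(3) by simp
  qed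
  then have "inj_on f (vec.span C)"
    using C(1) by (simp add: inj_on_def vec.span_eq_iff[THEN iffD2])
  then have "vec.dim (f ` C) = vec.dim C"
    using f vec.dim_image_eq by blast
  moreover have "f ` W = f ` C"
    using C(2,5) by (force simp: lin)
  ultimately show ?thesis
    using C(4) by simp
qed

lemma card_subspace:
  fixes W :: "('a::{field,finite} ^ 'n) set"
  assumes "vec.subspace W"
  shows "card W = CARD('a) ^ vec.dim W"
proof -
  have card_span: "card (vec.span B) = CARD('a) ^ card B" if "finite B" "vec.independent B"
    for B :: "('a ^ 'n) set"
    using that
  proof (induction B rule: finite_induct)
    case empty
    then show ?case by simp
  next
    case (insert b B)
    have ind: "vec.independent B" and b: "b \<notin> vec.span B"
      using insert.prems insert.hyps by (simp_all add: vec.independent_insert)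
    let ?f = "\<lambda>(k, x). k *s b + x"
    have inj: "inj_on ?f (UNIV \<times> vec.span B)"
    proof (rule inj_onI, clarsimp)
      fix k x k' x'
      assume x: "x \<in> vec.span B" "x' \<in> vec.span B" and eq: "k *s b + x = k' *s b + x'"
      have "(k - k') *s b = x' - x"
        using eq by (simp add: vec.scale_left_diff_distrib algebra_simps)
      then have "(k - k') *s b \<in> vec.span B"
        using x by (simp add: vec.span_diff)
      \<comment> \<open>If \<open>k - k'\<close> were nonzero, dividing by it would put
        \<open>b\<close> itself into the span of \<open>B\<close>.\<close>
      then have "inverse (k - k') *s ((k - k') *s b) \<in> vec.span B"
        by (rule vec.span_scale)
      then have "k - k' = 0"
        using b by (metis vec.scale_scale left_inverse vec.scale_one)
      then show "k = k' \<and> x = x'"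
        using eq by simp
    qed
    have img: "?f ` (UNIV \<times> vec.span B) = vec.span (insert b B)"
    proof (intro equalityI subsetI)
      fix v assume "v \<in> ?f ` (UNIV \<times> vec.span B)"
      then obtain k x where "v = k *s b + x" "x \<in> vec.span B"
        by auto
      then show "v \<in> vec.span (insert b B)"
        by (auto simp: vec.span_insert intro!: exI[where x = k])
    next
      fix v assume "v \<in> vec.span (insert b B)"
      then obtain k where "v - k *s b \<in> vec.span B"
        by (auto simp: vec.span_insert)
      then show "v \<in> ?f ` (UNIV \<times> vec.span B)"
        by (intro image_eqI[where x = "(k, v - k *s b)"]) auto
    qed
    show ?case
      using card_image[OF inj] insert.IH[OF ind] insert.hyps
      by (simp add: img card_cartesian_product)
  qed
  obtain B where B: "B \<subseteq> W" "vec.independent B" "W \<subseteq> vec.span B" "card B = vec.dim W"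
    using vec.basis_exists by blast
  then have "vec.span B = W"
    using assms by (simp add: vec.span_subspace)
  then show ?thesis
    using card_span[of B] B vec.finiteI_independent by metis
qed

section \<open>The projection from \<open>Sigma_last\<close> and its restriction to
  \<open>Sigma_first\<close>\<close>

text \<open>The projection with kernel \<open>Sigma_last\<close>. It maps \<open>Sigma_first\<close>
  isomorphically onto \<open>'a ^ 4\<close>, so subspaces of \<open>Sigma_first\<close> can be
  compared with projections of arbitrary subspaces.\<close>

definition first_half :: "'a ^ (4 + 4) \<Rightarrow> 'a ^ 4" where
  "first_half v = (\<chi> i. v $ Inl i)"

definition last_half :: "'a ^ (4 + 4) \<Rightarrow> 'a ^ 4" where
  "last_half v = (\<chi> i. v $ Inr i)"

lemma linear_first_half: "Vector_Spaces.linear (*s) (*s) (first_half :: 'a::field ^ (4 + 4) \<Rightarrow> _)"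
  by (simp add: Vector_Spaces.linear_iff vec.vector_space_axioms first_half_def vec_eq_iff)

lemma first_half_simps [simp]:
  fixes v w :: "'a::field ^ (4 + 4)"
  shows "first_half (v + w) = first_half v + first_half w"
    "first_half (v - w) = first_half v - first_half w"
    "first_half 0 = (0 :: 'a ^ 4)"
  by (simp_all add: first_half_def vec_eq_iff)

lemma halves_eqI: "first_half v = first_half w \<Longrightarrow> last_half v = last_half w \<Longrightarrow> v = w"
  by (auto simp: first_half_def last_half_def vec_eq_iff elim: sum.exhaust) (metis sum.exhaust)

lemma sum_halves:
  fixes g :: "4 + 4 \<Rightarrow> 'b::comm_monoid_add"
  shows "sum g UNIV = (\<Sum>i\<in>UNIV. g (Inl i)) + (\<Sum>i\<in>UNIV. g (Inr i))"
  using sum.Plus[of UNIV UNIV g] by (simp add: o_def)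

lemma mem_Sigma_last_iff:
  "v \<in> Sigma_last \<longleftrightarrow> first_half v = (0 :: 'a::field ^ 4)"
proof
  have "Sigma_last \<subseteq> {v :: 'a ^ (4 + 4). first_half v = 0}"
    unfolding Sigma_last_def
    by (intro vec.span_minimal vec.linear_subspace_kernel[OF linear_first_half])
      (auto simp: first_half_def vec_eq_iff axis_def)
  then show "v \<in> Sigma_last \<Longrightarrow> first_half v = 0"
    by blast
next
  assume "first_half v = 0"
  then have "v = (\<Sum>i\<in>UNIV. v $ Inr i *s axis (Inr i) 1)"
    using basis_expansion[of v] by (simp add: sum_halves first_half_def vec_eq_iff)
  also have "\<dots> \<in> Sigma_last"
    unfolding Sigma_last_def by (intro vec.span_sum vec.span_scale vec.span_base) auto
  finally show "v \<in> Sigma_last" .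
qed

lemma mem_Sigma_first_iff:
  "v \<in> Sigma_first \<longleftrightarrow> last_half v = (0 :: 'a::field ^ 4)"
proof
  have "vec.subspace {v :: 'a ^ (4 + 4). last_half v = 0}"
    by (auto simp: vec.subspace_def last_half_def vec_eq_iff)
  then have "Sigma_first \<subseteq> {v :: 'a ^ (4 + 4). last_half v = 0}"
    unfolding Sigma_first_def
    by (intro vec.span_minimal) (auto simp: last_half_def vec_eq_iff axis_def)
  then show "v \<in> Sigma_first \<Longrightarrow> last_half v = 0"
    by blast
next
  assume "last_half v = 0"
  then have "v = (\<Sum>i\<in>UNIV. v $ Inl i *s axis (Inl i) 1)"
    using basis_expansion[of v] by (simp add: sum_halves last_half_def vec_eq_iff)
  also have "\<dots> \<in> Sigma_first"
    unfolding Sigma_first_def by (intro vec.span_sum vec.span_scale vec.span_base) auto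
  finally show "v \<in> Sigma_first" .
qed

lemma subspace_Sigma_last [simp]: "vec.subspace Sigma_last"
  by (simp add: Sigma_last_def)

lemma solid_Sigma_last: "solid (Sigma_last :: ('a::field ^ (4 + 4)) set)"
proof -
  have "(Sigma_last :: ('a ^ (4 + 4)) set) = {x. \<forall>i. i \<notin> range Inr \<longrightarrow> x $ i = 0}"
    by (auto simp: mem_Sigma_last_iff first_half_def vec_eq_iff) (metis sum.exhaust rangeI)
  moreover have "vec.dim {x :: 'a ^ (4 + 4). \<forall>i. i \<notin> range Inr \<longrightarrow> x $ i = 0}
      = card (range (Inr :: 4 \<Rightarrow> 4 + 4))"
    by (rule dim_substandard_cart)
  ultimately show ?thesis
    by (simp add: flat_def card_image)
qed

text \<open>Rank-nullity for \<open>first_half\<close>. The dimension counts for planes and solids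
  below rest on it: fixing two of the three dimensions fixes the third.\<close>

lemma dim_Int_Sigma_last:
  assumes "vec.subspace W"
  shows "vec.dim W = vec.dim (W \<inter> Sigma_last) + vec.dim (first_half ` W)"
proof -
  have "W \<inter> Sigma_last = {x \<in> W. first_half x = 0}"
    by (auto simp: mem_Sigma_last_iff)
  then show ?thesis
    using dim_kernel_plus_dim_image[OF linear_first_half assms] by simp
qed

lemma subspace_first_half_image: "vec.subspace W \<Longrightarrow> vec.subspace (first_half ` W)"
  using vec.linear_subspace_image[OF linear_first_half] .

lemma first_half_inj_Sigma_first:
  "v \<in> Sigma_first \<Longrightarrow> w \<in> Sigma_first \<Longrightarrow> first_half v = first_half w \<Longrightarrow> v = w"
  for v w :: "'a::field ^ (4 + 4)"
  by (simp add: mem_Sigma_first_iff halves_eqI)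

lemma Sigma_first_Int_Sigma_last:
  "Sigma_first \<inter> Sigma_last = {0 :: 'a::field ^ (4 + 4)}"
proof -
  have "(0 :: 'a ^ (4 + 4)) \<in> Sigma_first"
    by (simp add: Sigma_first_def vec.span_zero)
  then show ?thesis
    using first_half_inj_Sigma_first[of _ "0 :: 'a ^ (4 + 4)"] by (auto simp: mem_Sigma_last_iff)
qed

lemma dim_first_half_Sigma_first:
  assumes "vec.subspace W" "W \<subseteq> Sigma_first"
  shows "vec.dim (first_half ` W) = vec.dim W"
proof -
  have "W \<inter> Sigma_last \<subseteq> {0}"
    using assms(2) Sigma_first_Int_Sigma_last by blast
  then show ?thesis
    using dim_Int_Sigma_last[OF assms(1)] by (simp add: vec.dim_eq_0[THEN iffD2])
qed

text \<open>Since it contains the kernel \<open>Sigma_last\<close> of the projection,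
  \<open>Gamma_span l'\<close> is the full preimage of the projection of \<open>l'\<close>.\<close>

lemma mem_Gamma_span_iff:
  assumes "vec.subspace l'"
  shows "v \<in> Gamma_span l' \<longleftrightarrow> first_half v \<in> first_half ` l'"
proof
  assume "v \<in> Gamma_span l'"
  then obtain s x where "s \<in> Sigma_last" "x \<in> l'" "v = s + x"
    using assms by (auto simp: Gamma_span_def vec.span_Un vec.span_eq_iff[THEN iffD2])
  then show "first_half v \<in> first_half ` l'"
    by (auto simp: mem_Sigma_last_iff)
next
  assume "first_half v \<in> first_half ` l'"
  then obtain x where x: "x \<in> l'" "first_half v = first_half x"
    by blast
  have "v - x \<in> Sigma_last"
    using x by (simp add: mem_Sigma_last_iff)
  then have "(v - x) + x \<in> Gamma_span l'"
    unfolding Gamma_span_def using x(1) by (intro vec.span_add vec.span_base) auto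
  then show "v \<in> Gamma_span l'"
    by simp
qed

text \<open>Inverts the identification of \<open>Sigma_first\<close> with \<open>'a ^ 4\<close>. It
  produces the line or point of \<open>Sigma_first\<close> that has the same projection as a given
  plane.\<close>

lemma lift_to_Sigma_first:
  fixes L :: "('a::field ^ 4) set"
  assumes "vec.subspace L"
  obtains l' where "flat (vec.dim L) l'" "l' \<subseteq> Sigma_first" "first_half ` l' = L"
proof -
  let ?l = "{v \<in> Sigma_first. first_half v \<in> L}"
  have "?l = Sigma_first \<inter> {v. first_half v \<in> L}"
    by blast
  then have sub: "vec.subspace ?l"
    using vec.linear_subspace_linear_preimage[OF linear_first_half assms]
    by (simp add: Sigma_first_def vec.subspace_inter)
  have "x \<in> first_half ` ?l" if "x \<in> L" for x
  proof -
    let ?v = "(\<chi> k. case k of Inl i \<Rightarrow> x $ i | Inr i \<Rightarrow> 0) :: 'a ^ (4 + 4)"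
    have "first_half ?v = x" "last_half ?v = 0"
      by (simp_all add: first_half_def last_half_def vec_eq_iff)
    then show ?thesis
      using that by (intro image_eqI[where x = ?v]) (simp_all add: mem_Sigma_first_iff)
  qed
  then have img: "first_half ` ?l = L"
    by blast
  then have "flat (vec.dim L) ?l"
    using dim_first_half_Sigma_first[OF sub] sub by (simp add: flat_def)
  then show thesis
    using that[of ?l] img by blast
qed

section \<open>Solids of the span of \<open>Sigma_last\<close> and a line of
  \<open>Sigma_first\<close>\<close>

lemma flat_subset_eq:
  "flat k U \<Longrightarrow> flat k W \<Longrightarrow> U \<subseteq> W \<Longrightarrow> U = W"
  using vec.subspace_dim_equal[of U W] by (simp add: flat_def)

text \<open>A trace of dimension 2 leaves dimension 4 - 2 = 2 for the projection of
  \<open>W\<close>, which lies inside the equally large projection of \<open>l'\<close>.\<close>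

lemma first_half_solid_in_Gamma_span:
  assumes "line l'" "l' \<subseteq> Sigma_first" "solid W" "W \<subseteq> Gamma_span l'" "line (W \<inter> Sigma_last)"
  shows "first_half ` W = first_half ` l'"
proof (rule flat_subset_eq[of 2])
  have sub: "vec.subspace W" "vec.subspace l'"
    using assms by (simp_all add: flat_def)
  show "line (first_half ` W)"
    using dim_Int_Sigma_last[OF sub(1)] assms subspace_first_half_image[OF sub(1)]
    by (simp add: flat_def)
  show "line (first_half ` l')"
    using dim_first_half_Sigma_first[OF sub(2)] assms subspace_first_half_image[OF sub(2)]
    by (simp add: flat_def)
  show "first_half ` W \<subseteq> first_half ` l'"
    using assms(4) mem_Gamma_span_iff[OF sub(2)] by auto
qed

text \<open>A solid of \<open>\<langle>\<Sigma>, \<ell>'\<rangle>\<close> meeting \<open>\<Sigma>\<close> in the line \<open>l\<close> is determined by its unique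
  points \<open>e\<^sub>i + c\<^sub>i\<close>, where \<open>e\<^sub>1, e\<^sub>2\<close> is a basis of \<open>\<ell>'\<close> and the \<open>c\<^sub>i\<close> lie in a fixed
  complement of \<open>l\<close> in \<open>\<Sigma>\<close>.\<close>

lemma card_solids_through_line:
  fixes l l' :: "('a::{field,finite} ^ (4 + 4)) set"
  assumes l': "line l'" "l' \<subseteq> Sigma_first" and l: "line l" "l \<subseteq> Sigma_last"
  shows "card {W. solid W \<and> W \<subseteq> Gamma_span l' \<and> W \<inter> Sigma_last = l} = CARD('a) ^ 4"
proof -
  let ?S = "{W. solid W \<and> W \<subseteq> Gamma_span l' \<and> W \<inter> Sigma_last = l}"
  have sub: "vec.subspace l" "vec.subspace l'" and dl: "vec.dim l = 2" "vec.dim l' = 2"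
    using l l' by (simp_all add: flat_def)
  obtain C where C: "vec.subspace C" "C \<subseteq> Sigma_last" "l \<inter> C = {0}"
    "vec.dim l + vec.dim C = vec.dim (Sigma_last :: ('a ^ (4 + 4)) set)"
    "\<And>w. w \<in> Sigma_last \<Longrightarrow> \<exists>u\<in>l. \<exists>c\<in>C. w = u + c"
    using subspace_complement_exists[OF sub(1) subspace_Sigma_last l(2)] by metis
  have "vec.dim C = 2"
    using C(4) dl solid_Sigma_last[where 'a = 'a] by (simp add: flat_def)
  then have cardC: "card C = CARD('a) ^ 2"
    using card_subspace[OF C(1)] by simp
  obtain B where B: "B \<subseteq> l'" "vec.independent B" "l' \<subseteq> vec.span B" "card B = 2"
    using vec.basis_exists[of l'] dl by auto
  then obtain e1 e2 where Be: "B = {e1, e2}"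
    by (auto simp: card_2_iff)
  have e: "e1 \<in> l'" "e2 \<in> l'" and spe: "vec.span {e1, e2} = l'"
    using B Be sub(2) by (simp_all add: vec.span_subspace)
  have L: "vec.dim (first_half ` l') = 2"
    using dim_first_half_Sigma_first[OF sub(2) l'(2)] dl by simp
  let ?f = "\<lambda>(c1, c2). vec.span (insert (e1 + c1) (insert (e2 + c2) l))"
  have mem: "?f (c1, c2) \<in> ?S" if c: "c1 \<in> C" "c2 \<in> C" for c1 c2
  proof -
    let ?W = "?f (c1, c2)"
    have e': "e1 + c1 \<in> ?W" "e2 + c2 \<in> ?W" and lW: "l \<subseteq> ?W"
      by (auto intro: vec.span_base)
    have fc: "first_half c1 = 0" "first_half c2 = 0"
      using c C(2) by (auto simp: mem_Sigma_last_iff)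
    have "0 \<in> first_half ` l'"
      using vec.subspace_0[OF subspace_first_half_image[OF sub(2)]] .
    then have "insert (e1 + c1) (insert (e2 + c2) l) \<subseteq> {v. first_half v \<in> first_half ` l'}"
      using l(2) e fc by (auto simp: mem_Sigma_last_iff subset_iff)
    then have G: "?W \<subseteq> {v. first_half v \<in> first_half ` l'}"
      unfolding prod.case
      by (intro vec.span_minimal vec.linear_subspace_linear_preimage[OF linear_first_half]
          subspace_first_half_image sub)
    have "first_half ` {e1, e2} \<subseteq> first_half ` ?W"
      using e' fc by (auto simp: image_iff) (metis add.right_neutral first_half_simps(1))+
    then have "vec.span (first_half ` {e1, e2}) \<subseteq> first_half ` ?W"
      by (intro vec.span_minimal subspace_first_half_image) auto
    then have "first_half ` l' \<subseteq> first_half ` ?W"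
      using vec.linear_span_image[OF linear_first_half, of "{e1, e2}"] spe by simp
    then have img: "first_half ` ?W = first_half ` l'"
      using G by blast
    \<comment> \<open>Only two generators are added to \<open>l\<close>, so the dimension is at most
      4. The projection contributes 2 and the trace at least 2, so equality holds and the trace is
      no larger than \<open>l\<close>.\<close>
    have "vec.dim ?W \<le> 4"
      using vec.dim_insert[of "e1 + c1" "insert (e2 + c2) l"] vec.dim_insert[of "e2 + c2" l] dl
      by (simp split: if_splits)
    moreover have "vec.dim ?W = vec.dim (?W \<inter> Sigma_last) + 2"
      using dim_Int_Sigma_last[of ?W] img L by simp
    moreover have "l \<subseteq> ?W \<inter> Sigma_last"
      using lW l(2) by blast
    moreover from this have "2 \<le> vec.dim (?W \<inter> Sigma_last)"
      using vec.dim_subset dl by metis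
    ultimately have "vec.dim ?W = 4" "?W \<inter> Sigma_last = l"
      using vec.subspace_dim_equal[of l "?W \<inter> Sigma_last"] sub dl
      by (simp_all add: vec.subspace_inter)
    then show ?thesis
      using G mem_Gamma_span_iff[OF sub(2)] by (auto simp: flat_def)
  qed
  have inj: "inj_on ?f (C \<times> C)"
  proof (rule inj_onI, clarify)
    fix c1 c2 d1 d2
    assume c: "c1 \<in> C" "c2 \<in> C" "d1 \<in> C" "d2 \<in> C"
      and eq: "vec.span (insert (e1 + c1) (insert (e2 + c2) l)) =
        vec.span (insert (e1 + d1) (insert (e2 + d2) l))"
    let ?W = "?f (c1, c2)"
    have W: "?W \<inter> Sigma_last = l"
      using mem[OF c(1,2)] by simp
    \<comment> \<open>Two points of the solid over the same \<open>e\<close> differ by a vector of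
      both \<open>l\<close> and its complement \<open>C\<close>.\<close>
    have "c = d" if "e + c \<in> ?W" "e + d \<in> ?W" "c \<in> C" "d \<in> C" for e c d
    proof -
      have "c - d \<in> ?W"
        using vec.span_diff[of "e + c" _ "e + d"] that by simp
      moreover have "c - d \<in> C"
        using that C(1) vec.subspace_diff by blast
      ultimately have "c - d \<in> l \<inter> C"
        using W C(2) by blast
      then show ?thesis
        using C(3) by simp
    qed
    moreover have "e1 + c1 \<in> ?W" "e2 + c2 \<in> ?W" "e1 + d1 \<in> ?W" "e2 + d2 \<in> ?W"
      using eq by (auto intro: vec.span_base)
    ultimately show "c1 = d1 \<and> c2 = d2"
      using c by blast
  qed
  have img: "?f ` (C \<times> C) = ?S"
  proof (intro equalityI subsetI)
    fix W assume "W \<in> ?f ` (C \<times> C)"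
    then show "W \<in> ?S"
      using mem by auto
  next
    fix W assume W: "W \<in> ?S"
    then have subW: "vec.subspace W" and lW: "l \<subseteq> W"
      by (auto simp: flat_def)
    have img: "first_half ` W = first_half ` l'"
      using first_half_solid_in_Gamma_span[OF l', of W] W l(1) by simp
    have ex: "\<exists>c\<in>C. e + c \<in> W" if e: "e \<in> l'" for e
    proof -
      obtain w where w: "w \<in> W" "first_half w = first_half e"
        using img e by (metis imageE imageI)
      \<comment> \<open>The vector \<open>w - e\<close> lies in \<open>Sigma_last\<close> and splits
        along \<open>l\<close> and \<open>C\<close>. Its part \<open>u\<close> in \<open>l\<close>
        already belongs to \<open>W\<close> and can be subtracted.\<close>
      then obtain u c where uc: "u \<in> l" "c \<in> C" "w - e = u + c"
        using C(5)[of "w - e"] by (auto simp: mem_Sigma_last_iff)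
      have "e + c = w - u"
        using uc(3) by (simp add: algebra_simps)
      then show ?thesis
        using uc(1,2) w(1) lW vec.subspace_diff[OF subW, of w u] by (metis subsetD)
    qed
    obtain c1 c2 where c: "c1 \<in> C" "c2 \<in> C" "e1 + c1 \<in> W" "e2 + c2 \<in> W"
      using ex e by blast
    have "?f (c1, c2) \<subseteq> W"
      unfolding prod.case using c lW subW by (intro vec.span_minimal) auto
    moreover have "solid (?f (c1, c2))" "solid W"
      using mem[OF c(1,2)] W by simp_all
    ultimately have "W = ?f (c1, c2)"
      using flat_subset_eq by metis
    then show "W \<in> ?f ` (C \<times> C)"
      using c by blast
  qed
  have "card ?S = card (C \<times> C)"
    using card_image[OF inj] unfolding img .
  then show ?thesis
    by (simp add: card_cartesian_product cardC flip: power_add)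
qed

section \<open>Spreads and parallelisms\<close>

text \<open>The spreads of a parallelism partition the lines of \<open>T\<close>, so the count is
  the number of spreads times the size of one spread.\<close>

lemma card_lines_one_parallelism:
  fixes T :: "('a::{field,finite} ^ 'n) set"
  assumes "one_parallelism T P"
  shows "card {l. line l \<and> l \<subseteq> T} = (CARD('a)^2 + CARD('a) + 1) * (CARD('a)^2 + 1)"
proof -
  have sp: "line_spread T S" if "S \<in> P" for S
    using assms that by (simp add: one_parallelism_def)
  have ex: "\<exists>!S. S \<in> P \<and> l \<in> S" if "line l" "l \<subseteq> T" for l
    using assms that by (simp add: one_parallelism_def)
  have in_T: "line l \<and> l \<subseteq> T" if "S \<in> P" "l \<in> S" for S l
    using sp that by (simp add: line_spread_def)
  have "{l. line l \<and> l \<subseteq> T} = \<Union>P"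
    using ex in_T by (intro equalityI subsetI) (simp, metis UnionI, blast)
  moreover have "pairwise disjnt P"
    unfolding pairwise_def disjnt_iff using ex in_T by metis
  then have "card (\<Union>P) = (\<Sum>S\<in>P. card S)"
    by (intro card_Union_disjoint) simp_all
  moreover have "\<dots> = card P * (CARD('a)^2 + 1)"
    using sp by (simp add: line_spread_def)
  ultimately show ?thesis
    using assms by (simp add: one_parallelism_def)
qed

lemma spread_containing_eqI:
  assumes "one_parallelism T P" "S \<in> P" "l \<in> S"
  shows "spread_containing P l = S"
proof -
  have "line l" "l \<subseteq> T"
    using assms by (auto simp: one_parallelism_def line_spread_def)
  then have "\<exists>!S. S \<in> P \<and> l \<in> S"
    using assms(1) by (simp add: one_parallelism_def)
  then show ?thesis
    unfolding spread_containing_def using assms(2,3) by (auto intro!: the_equality)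
qed

lemma spread_containing_in:
  assumes "one_parallelism T P" "line l" "l \<subseteq> T"
  shows "spread_containing P l \<in> P"
proof -
  obtain S where "S \<in> P" "l \<in> S"
    using assms by (auto simp: one_parallelism_def)
  then show ?thesis
    using spread_containing_eqI[OF assms(1)] by simp
qed

lemma line_spread_bij_image:
  assumes "one_parallelism T P" "one_parallelism T' P'" "bij_betw \<mu> P' P" "line l'" "l' \<subseteq> T'"
  shows "line_spread T (\<mu> (spread_containing P' l'))"
proof -
  have "\<mu> (spread_containing P' l') \<in> P"
    using spread_containing_in[OF assms(2,4,5)] assms(3) by (rule bij_betw_apply[rotated])
  then show ?thesis
    using assms(1) by (simp add: one_parallelism_def)
qed

section \<open>Matrices acting on row vectors, lifted solids and the code\<close>

lemma linear_vector_matrix_mult: "Vector_Spaces.linear (*s) (*s) (\<lambda>x. x v* (D :: 'a::field ^ 'n ^ 'm))"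
  by (simp add: Vector_Spaces.linear_iff vec.vector_space_axioms vector_matrix_mult_def vec_eq_iff
      algebra_simps sum.distrib sum_distrib_left)

lemma vector_matrix_mult_eq_sum_rows:
  "x v* D = (\<Sum>i\<in>UNIV. x $ i *s row i (D :: 'a::field ^ 'n ^ 'm))"
  by (simp add: vector_matrix_mult_def vec_eq_iff row_def)

lemma axis_vector_matrix_mult: "axis i 1 v* D = row i (D :: 'a::field ^ 'n ^ 'm)"
  by (simp add: vector_matrix_mult_def vec_eq_iff row_def axis_def if_distrib if_distribR
      cong: if_cong)

lemma range_vector_matrix_mult:
  "range (\<lambda>x. x v* (D :: 'a::field ^ 'n ^ 'm)) = vec.span (rows D)"
proof
  have "x v* D \<in> vec.span (rows D)" for x
    unfolding vector_matrix_mult_eq_sum_rows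
    by (intro vec.span_sum vec.span_scale vec.span_base) (auto simp: rows_def)
  then show "range (\<lambda>x. x v* D) \<subseteq> vec.span (rows D)"
    by blast
  show "vec.span (rows D) \<subseteq> range (\<lambda>x. x v* D)"
    using vec.linear_subspace_image[OF linear_vector_matrix_mult vec.subspace_UNIV]
    by (intro vec.span_minimal) (auto simp: rows_def simp flip: axis_vector_matrix_mult)
qed

text \<open>Rank-nullity, the image being the row space. It translates the distance of the code: a
  difference of rank at least 2 has a left kernel of dimension at most 2.\<close>

lemma dim_left_kernel_plus_rank:
  fixes D :: "'a::field ^ 'n ^ 'm"
  shows "vec.dim {x. x v* D = 0} + rank D = CARD('m)"
proof -
  have "vec.dim (UNIV :: ('a ^ 'm) set) = CARD('m)"
    using dim_substandard_cart[of "UNIV :: 'm set", where 'a = 'a] by simp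
  then show ?thesis
    using dim_kernel_plus_dim_image[OF linear_vector_matrix_mult[of D] vec.subspace_UNIV]
    by (simp add: range_vector_matrix_mult row_rank_def_gen)
qed

text \<open>Combining the rows of \<open>(I | A)\<close> with coefficients \<open>x\<close> gives
  the vector with halves \<open>x\<close> and \<open>x v* A\<close>; the lifted solid is thus the
  graph of \<open>A\<close> acting on row vectors.\<close>

lemma mem_lifted_solid_iff:
  fixes A :: "'a::field ^ 4 ^ 4"
  shows "v \<in> lifted_solid A \<longleftrightarrow> last_half v = first_half v v* A"
proof -
  let ?r = "\<lambda>x. x v* identity_augmented A"
  have first: "first_half (?r x) = x" for x
    by (simp add: first_half_def vector_matrix_mult_def identity_augmented_def mat_def vec_eq_iff
        if_distrib cong: if_cong)
  have last: "last_half (?r x) = x v* A" for x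
    by (simp add: last_half_def vector_matrix_mult_def identity_augmented_def vec_eq_iff)
  have "v \<in> lifted_solid A \<longleftrightarrow> v \<in> range ?r"
    by (simp add: lifted_solid_def range_vector_matrix_mult)
  also have "\<dots> \<longleftrightarrow> v = ?r (first_half v)"
    using first by auto
  also have "\<dots> \<longleftrightarrow> last_half v = first_half v v* A"
    using first last halves_eqI by metis
  finally show ?thesis .
qed

lemma lifted_solid_Int_Sigma_last: "lifted_solid A \<inter> Sigma_last = {0 :: 'a::field ^ (4 + 4)}"
proof -
  have "v = 0" if "v \<in> lifted_solid A" "v \<in> Sigma_last" for v
    using that by (intro halves_eqI)
      (simp_all add: mem_lifted_solid_iff mem_Sigma_last_iff, simp add: last_half_def vec_eq_iff)
  then show ?thesis
    by (auto simp: lifted_solid_def vec.span_zero mem_Sigma_last_iff)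
qed

lemma ex_lifted_solid_point:
  fixes A :: "'a::field ^ 4 ^ 4"
  shows "\<exists>v\<in>lifted_solid A. first_half v = x \<and> last_half v = x v* A"
proof -
  let ?v = "(\<chi> k. case k of Inl i \<Rightarrow> x $ i | Inr i \<Rightarrow> (x v* A) $ i) :: 'a ^ (4 + 4)"
  have "first_half ?v = x" "last_half ?v = x v* A"
    by (simp_all add: first_half_def last_half_def vec_eq_iff)
  then show ?thesis
    by (intro bexI[where x = ?v]) (simp_all add: mem_lifted_solid_iff)
qed

lemma solid_lifted_solid: "solid (lifted_solid (A :: 'a::field ^ 4 ^ 4))"
proof -
  have sub: "vec.subspace (lifted_solid A)"
    by (simp add: lifted_solid_def)
  have "first_half ` lifted_solid A = UNIV"
    using ex_lifted_solid_point[of A] by (metis UNIV_eq_I imageI)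
  moreover have "vec.dim (UNIV :: ('a ^ 4) set) = 4"
    using dim_substandard_cart[of "UNIV :: 4 set", where 'a = 'a] by simp
  ultimately show ?thesis
    using dim_Int_Sigma_last[OF sub] sub by (simp add: flat_def lifted_solid_Int_Sigma_last)
qed

lemma inj_lifted_solid: "inj (lifted_solid :: 'a::field ^ 4 ^ 4 \<Rightarrow> _)"
proof (rule injI)
  fix A B :: "'a ^ 4 ^ 4"
  assume eq: "lifted_solid A = lifted_solid B"
  have "x v* A = x v* B" for x
    using ex_lifted_solid_point[of A x] eq by (auto simp: mem_lifted_solid_iff)
  then have "row i A = row i B" for i
    by (simp flip: axis_vector_matrix_mult)
  then show "A = B"
    by (simp add: row_def vec_eq_iff)
qed

text \<open>Two code words agreeing on a three-dimensional space of row vectors differ by a matrix of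
  rank at most 1, so restriction to the space is injective on the code; as there are exactly
  \<open>q^12\<close> linear maps to choose from, it is also surjective.\<close>

lemma mrd_code_covers:
  fixes \<A> :: "('a::{field,finite} ^ 4 ^ 4) set"
  assumes \<A>: "mrd_code_4_4_2 \<A>" and V: "flat 3 V" and V0: "vec.dim (V \<inter> Sigma_last) = 0"
  shows "\<exists>A\<in>\<A>. V \<subseteq> lifted_solid A"
proof -
  have subV: "vec.subspace V"
    using V by (simp add: flat_def)
  have dV: "vec.dim (first_half ` V) = 3"
    using V dim_Int_Sigma_last[OF subV] unfolding V0 by (simp add: flat_def)
  obtain B where B: "B \<subseteq> first_half ` V" "vec.independent B" "first_half ` V \<subseteq> vec.span B" "card B = 3"
    using vec.basis_exists[of "first_half ` V"] dV by metis
  \<comment> \<open>A linear map on the projection of \<open>V\<close> is encoded by its values on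
    the basis \<open>B\<close>. Using extensional functions, there are exactly (q^4)^3 = q^12 such
    encodings, as many as code words.\<close>
  let ?\<Phi> = "\<lambda>A. restrict (\<lambda>b. b v* A) B"
  let ?F = "B \<rightarrow>\<^sub>E (UNIV :: ('a ^ 4) set)"
  have "inj_on ?\<Phi> \<A>"
  proof (rule inj_onI, rule ccontr)
    fix A A' assume A: "A \<in> \<A>" "A' \<in> \<A>" "A \<noteq> A'" and eq: "?\<Phi> A = ?\<Phi> A'"
    have "b v* (A - A') = 0" if "b \<in> B" for b
      using fun_cong[OF eq, of b] that by (simp add: vector_matrix_mult_diff_rdistrib)
    then have "B \<subseteq> {x. x v* (A - A') = 0}"
      by blast
    then have "3 \<le> vec.dim {x. x v* (A - A') = 0}"
      using vec.independent_card_le_dim B(2,4) by metis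
    moreover have "rank (A - A') \<ge> 2"
      using \<A> A by (simp add: mrd_code_4_4_2_def)
    ultimately show False
      using dim_left_kernel_plus_rank[of "A - A'"] by simp
  qed
  then have "card (?\<Phi> ` \<A>) = CARD('a) ^ 12"
    using \<A> by (simp add: card_image mrd_code_4_4_2_def)
  moreover have "card ?F = CARD('a) ^ 12"
    using B(4) by (simp add: card_PiE flip: power_mult)
  moreover have "?\<Phi> ` \<A> \<subseteq> ?F"
    by auto
  ultimately have surj: "?\<Phi> ` \<A> = ?F"
    by (intro card_subset_eq) (simp_all add: finite_PiE)
  have "\<forall>b\<in>B. \<exists>v\<in>V. first_half v = b"
    using B(1) by blast
  \<comment> \<open>\<open>g\<close> lifts the basis back to \<open>V\<close>. Sending
    \<open>b\<close> to \<open>last_half (g b)\<close> describes the linear map whose graph is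
    \<open>V\<close>, and surjectivity yields a code word inducing it.\<close>
  then obtain g where g: "\<And>b. b \<in> B \<Longrightarrow> g b \<in> V \<and> first_half (g b) = b"
    by metis
  have "restrict (\<lambda>b. last_half (g b)) B \<in> ?\<Phi> ` \<A>"
    unfolding surj by auto
  then obtain A where A: "A \<in> \<A>" and eq: "restrict (\<lambda>b. last_half (g b)) B = ?\<Phi> A"
    by blast
  have "last_half (g b) = b v* A" if "b \<in> B" for b
    using fun_cong[OF eq, of b] that by simp
  then have "g b \<in> V \<inter> lifted_solid A" if "b \<in> B" for b
    using g that by (simp add: mem_lifted_solid_iff)
  then have "B \<subseteq> first_half ` (V \<inter> lifted_solid A)"
    using g by (metis imageI subsetI)
  moreover have "vec.subspace (V \<inter> lifted_solid A)"
    using subV by (simp add: vec.subspace_inter lifted_solid_def)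
  ultimately have "vec.span B \<subseteq> first_half ` (V \<inter> lifted_solid A)"
    by (intro vec.span_minimal subspace_first_half_image)
  then have sub: "first_half ` V \<subseteq> first_half ` (V \<inter> lifted_solid A)"
    using B(3) by blast
  have "v \<in> lifted_solid A" if v: "v \<in> V" for v
  proof -
    obtain u where u: "u \<in> V" "u \<in> lifted_solid A" "first_half v = first_half u"
      using sub v by blast
    \<comment> \<open>Points of \<open>V\<close> are determined by their projection, because
      \<open>V\<close> meets \<open>Sigma_last\<close> trivially.\<close>
    have "v - u \<in> V \<inter> Sigma_last"
      using u v subV by (simp add: mem_Sigma_last_iff vec.subspace_diff)
    then have "v - u = 0"
      using V0 by auto
    then show ?thesis
      using u by simp
  qed
  then show ?thesis
    using A by blast
qed

section \<open>Planes meeting \<open>Sigma_last\<close> in a point or a line\<close>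

text \<open>Joining \<open>V\<close> with a spread line in \<open>Sigma_last\<close> through its
  point there adds one dimension and leaves the projection unchanged, so the trace grows to exactly
  that line.\<close>

lemma Z_solids_cover_plane_meeting_in_point:
  fixes V :: "('a::{field,finite} ^ (4 + 4)) set"
  assumes P: "one_parallelism Sigma_last \<P>" and P': "one_parallelism Sigma_first \<P>'"
    and \<mu>: "bij_betw \<mu> \<P>' \<P>"
    and V: "flat 3 V" "vec.dim (V \<inter> Sigma_last) = 1"
  shows "\<exists>l'. line l' \<and> l' \<subseteq> Sigma_first \<and> (\<exists>W\<in>Z_solids \<P>' \<mu> l'. V \<subseteq> W)"
proof -
  have subV: "vec.subspace V" and dV: "vec.dim V = 3" and dV': "vec.dim (first_half ` V) = 2"
    using V dim_Int_Sigma_last[of V] by (simp_all add: flat_def)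
  obtain l' where l': "line l'" "l' \<subseteq> Sigma_first" "first_half ` l' = first_half ` V"
    using lift_to_Sigma_first[OF subspace_first_half_image[OF subV]] dV' by metis
  let ?S = "\<mu> (spread_containing \<P>' l')"
  have S: "line_spread Sigma_last ?S"
    using line_spread_bij_image[OF P P' \<mu> l'(1,2)] .
  have "point (V \<inter> Sigma_last)"
    using V subV by (simp add: flat_def vec.subspace_inter)
  then obtain l where l: "l \<in> ?S" "V \<inter> Sigma_last \<subseteq> l"
    using S unfolding line_spread_def by (metis inf_le2)
  then have line_l: "line l" and lS: "l \<subseteq> Sigma_last"
    using S by (auto simp: line_spread_def)
  let ?W = "{x + y | x y. x \<in> V \<and> y \<in> l}"
  have sub_l: "vec.subspace l" and dl: "vec.dim l = 2"
    using line_l by (simp_all add: flat_def)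
  have subW: "vec.subspace ?W"
    using vec.subspace_sums[OF subV sub_l] .
  have VW: "V \<subseteq> ?W"
    using vec.subspace_0[OF sub_l] by force
  have lW: "l \<subseteq> ?W"
    using vec.subspace_0[OF subV] by force
  \<comment> \<open>The intersection is a single point, so the sum has dimension 3 + 2 - 1 =
    4.\<close>
  have "V \<inter> l = V \<inter> Sigma_last"
    using l(2) lS by blast
  then have dW: "vec.dim ?W = 4"
    using vec.dim_sums_Int[OF subV sub_l] V(2) dV dl by simp
  have "first_half (x + y) = first_half x" if "y \<in> l" for x y
    using that lS by (auto simp: mem_Sigma_last_iff)
  then have imgW: "first_half ` ?W = first_half ` l'"
    using l'(3) VW by (auto simp: image_iff)
  have "vec.dim (?W \<inter> Sigma_last) = 2"
    using dim_Int_Sigma_last[OF subW] imgW l'(3) dV' dW by simp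
  then have W_line: "?W \<inter> Sigma_last = l"
    using lW lS line_l subW by (intro flat_subset_eq[symmetric, of 2])
      (auto simp: flat_def vec.subspace_inter)
  have "?W \<subseteq> Gamma_span l'"
    using imgW mem_Gamma_span_iff[of l'] l'(1) by (auto simp: flat_def)
  moreover have "?W \<noteq> Sigma_last"
    using W_line dl dW by force
  ultimately have "?W \<in> Z_solids \<P>' \<mu> l'"
    unfolding Z_solids_def using W_line l(1) subW dW by (simp add: flat_def)
  then show ?thesis
    using l' VW by blast
qed

text \<open>Now the trace is already a line and must be kept, while the projection is only a point
  and must grow to a line. So \<open>V\<close> is extended by a point of a suitable
  \<open>l'\<close>.\<close>

lemma Z_solids_cover_plane_meeting_in_line:
  fixes V :: "('a::{field,finite} ^ (4 + 4)) set"
  assumes P: "one_parallelism Sigma_last \<P>" and P': "one_parallelism Sigma_first \<P>'"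
    and \<mu>: "bij_betw \<mu> \<P>' \<P>"
    and V: "flat 3 V" "vec.dim (V \<inter> Sigma_last) = 2"
  shows "\<exists>l'. line l' \<and> l' \<subseteq> Sigma_first \<and> (\<exists>W\<in>Z_solids \<P>' \<mu> l'. V \<subseteq> W)"
proof -
  have subV: "vec.subspace V" and dV: "vec.dim V = 3" and dV': "vec.dim (first_half ` V) = 1"
    using V dim_Int_Sigma_last[of V] by (simp_all add: flat_def)
  let ?l = "V \<inter> Sigma_last"
  have line_l: "line ?l"
    using V(2) subV by (simp add: flat_def vec.subspace_inter)
  obtain S where S: "S \<in> \<P>" "?l \<in> S"
    using P line_l unfolding one_parallelism_def by (metis inf_le2)
  \<comment> \<open>Surjectivity of \<open>\<mu>\<close> supplies the spread of
    \<open>Sigma_first\<close> that is matched with the trace of \<open>V\<close>.\<close>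
  obtain S' where S': "S' \<in> \<P>'" "\<mu> S' = S"
    using \<mu> S(1) by (metis bij_betw_imp_surj_on imageE)
  have spread': "line_spread Sigma_first S'"
    using P' S'(1) by (simp add: one_parallelism_def)
  obtain p' where p': "point p'" "p' \<subseteq> Sigma_first" "first_half ` p' = first_half ` V"
    using lift_to_Sigma_first[OF subspace_first_half_image[OF subV]] dV' by metis
  obtain l' where l': "l' \<in> S'" "p' \<subseteq> l'"
    using spread' p' unfolding line_spread_def by metis
  then have line_l': "line l'" and l'S: "l' \<subseteq> Sigma_first"
    using spread' by (auto simp: line_spread_def)
  have spr: "\<mu> (spread_containing \<P>' l') = S"
    using spread_containing_eqI[OF P' S'(1) l'(1)] S'(2) by simp
  have sub_l': "vec.subspace l'"
    using line_l' by (simp add: flat_def)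
  have dL: "vec.dim (first_half ` l') = 2"
    using dim_first_half_Sigma_first[OF sub_l' l'S] line_l' by (simp add: flat_def)
  have "p' \<noteq> l'"
    using p'(1) line_l' by (auto simp: flat_def)
  \<comment> \<open>Any vector of \<open>l'\<close> outside \<open>p'\<close> will do: its
    projection is not in that of \<open>V\<close>, but still in that of \<open>l'\<close>.\<close>
  then obtain x where x: "x \<in> l'" "x \<notin> p'"
    using l'(2) by blast
  have xV: "first_half x \<notin> first_half ` V"
  proof
    assume "first_half x \<in> first_half ` V"
    then obtain y where "y \<in> p'" "first_half x = first_half y"
      using p'(3) by (metis imageE)
    then show False
      using first_half_inj_Sigma_first[of x y] x p'(2) l'S by blast
  qed
  let ?W = "vec.span (insert x V)"
  have VW: "V \<subseteq> ?W" and xW: "x \<in> ?W"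
    by (auto intro: vec.span_base)
  have "x \<notin> vec.span V"
    using xV subV by (auto simp: vec.span_eq_iff[THEN iffD2])
  then have dW: "vec.dim ?W = 4"
    using dV by (simp add: vec.dim_insert)
  have "first_half ` V \<subseteq> first_half ` l'"
    using p'(3) l'(2) by (metis image_mono)
  then have "insert x V \<subseteq> {v. first_half v \<in> first_half ` l'}"
    using x(1) by blast
  then have WG: "?W \<subseteq> {v. first_half v \<in> first_half ` l'}"
    by (intro vec.span_minimal vec.linear_subspace_linear_preimage[OF linear_first_half]
        subspace_first_half_image sub_l')
  then have "vec.dim (first_half ` ?W) \<le> 2"
    using dL vec.dim_subset[of "first_half ` ?W" "first_half ` l'"] by force
  moreover have "vec.dim ?l \<le> vec.dim (?W \<inter> Sigma_last)"
    using VW by (intro vec.dim_subset) blast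
  moreover have "first_half ` V \<subset> first_half ` ?W"
    using VW xW xV by blast
  then have "vec.dim (first_half ` V) < vec.dim (first_half ` ?W)"
    using subV by (intro vec.dim_psubset)
      (simp add: vec.span_eq_iff[THEN iffD2] subspace_first_half_image)
  \<comment> \<open>The projection of \<open>?W\<close> has dimension above 1 and at most 2, leaving
    4 - 2 = 2 for the trace.\<close>
  ultimately have "vec.dim (?W \<inter> Sigma_last) = 2"
    using dim_Int_Sigma_last[of ?W] dW dV' by simp
  then have W_line: "?W \<inter> Sigma_last = ?l"
    using VW line_l by (intro flat_subset_eq[symmetric, of 2])
      (auto simp: flat_def vec.subspace_inter)
  have "?W \<subseteq> Gamma_span l'"
    using WG mem_Gamma_span_iff[OF sub_l'] by blast
  moreover have "?W \<noteq> Sigma_last"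
    using W_line V(2) dW by force
  ultimately have "?W \<in> Z_solids \<P>' \<mu> l'"
    unfolding Z_solids_def using W_line S(2) spr dW by (simp add: flat_def)
  then show ?thesis
    using line_l' l'S VW by blast
qed

section \<open>Counting the solids and assembling the covering design\<close>

text \<open>Sorting the solids by their trace on \<open>Sigma_last\<close> gives q^2 + 1 disjoint
  classes, one for each line of the spread, with q^4 solids in each.\<close>

lemma card_Z_solids:
  fixes \<P> \<P>' :: "('a::{field,finite} ^ (4 + 4)) set set set"
  assumes P: "one_parallelism Sigma_last \<P>" and P': "one_parallelism Sigma_first \<P>'"
    and \<mu>: "bij_betw \<mu> \<P>' \<P>" and l': "line l'" "l' \<subseteq> Sigma_first"
  shows "card (Z_solids \<P>' \<mu> l') = CARD('a)^4 * (CARD('a)^2 + 1)"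
proof -
  let ?S = "\<mu> (spread_containing \<P>' l')"
  let ?T = "\<lambda>l. {W. solid W \<and> W \<subseteq> Gamma_span l' \<and> W \<inter> Sigma_last = l}"
  have S: "line_spread Sigma_last ?S"
    using line_spread_bij_image[OF P P' \<mu> l'] .
  have "W \<noteq> Sigma_last" if "W \<inter> Sigma_last \<in> ?S" for W
    using S that solid_Sigma_last[where 'a = 'a] by (auto simp: line_spread_def flat_def)
  then have "Z_solids \<P>' \<mu> l' = (\<Union>l\<in>?S. ?T l)"
    unfolding Z_solids_def by blast
  also have "card \<dots> = (\<Sum>l\<in>?S. card (?T l))"
    by (intro card_UN_disjoint) auto
  also have "\<dots> = (\<Sum>l\<in>?S. CARD('a)^4)"
    using S card_solids_through_line[OF l'] by (intro sum.cong) (auto simp: line_spread_def)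
  also have "\<dots> = CARD('a)^4 * (CARD('a)^2 + 1)"
    using S by (simp add: line_spread_def)
  finally show ?thesis .
qed

text \<open>The trace separates these solids from the lifted ones and from
  \<open>Sigma_last\<close>; the projection separates the families of different lines
  \<open>l'\<close>.\<close>

lemma Z_solids_D:
  fixes \<P> \<P>' :: "('a::{field,finite} ^ (4 + 4)) set set set"
  assumes P: "one_parallelism Sigma_last \<P>" and P': "one_parallelism Sigma_first \<P>'"
    and \<mu>: "bij_betw \<mu> \<P>' \<P>" and l': "line l'" "l' \<subseteq> Sigma_first"
    and W: "W \<in> Z_solids \<P>' \<mu> l'"
  shows "solid W" "line (W \<inter> Sigma_last)" "first_half ` W = first_half ` l'"
proof -
  have "line_spread Sigma_last (\<mu> (spread_containing \<P>' l'))"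
    using line_spread_bij_image[OF P P' \<mu> l'] .
  then show "solid W" and line: "line (W \<inter> Sigma_last)"
    using W by (simp_all add: Z_solids_def line_spread_def)
  then show "first_half ` W = first_half ` l'"
    using first_half_solid_in_Gamma_span[OF l'] W by (simp add: Z_solids_def)
qed

theorem theorem5p2:
  fixes \<A> :: "('a::{field,finite} ^ 4 ^ 4) set"
    and \<P> \<P>' :: "('a ^ (4 + 4)) set set set"
    and \<mu> :: "('a ^ (4 + 4)) set set \<Rightarrow> ('a ^ (4 + 4)) set set"
    and \<X> \<Z> :: "('a ^ (4 + 4)) set set"
    and q :: nat
  assumes "q = CARD('a)"
    and "mrd_code_4_4_2 \<A>"
    and "\<X> = {lifted_solid A | A. A \<in> \<A>}"
    and "one_parallelism Sigma_last \<P>"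
    and "one_parallelism Sigma_first \<P>'"
    and "bij_betw \<mu> \<P>' \<P>"
    and "\<Z> = (\<Union>l' \<in> {l'. line l' \<and> l' \<subseteq> Sigma_first}. Z_solids \<P>' \<mu> l')"
  shows "card \<X> = q^12
    \<and> (\<forall>l'. line l' \<and> l' \<subseteq> Sigma_first \<longrightarrow> card (Z_solids \<P>' \<mu> l') = q^4 * (q^2 + 1))
    \<and> q_covering_design 8 4 3 (\<X> \<union> \<Z> \<union> {Sigma_last})
    \<and> card (\<X> \<union> \<Z> \<union> {Sigma_last}) = q^12 + q^4 * (q^2 + 1)^2 * (q^2 + q + 1) + 1"
proof -
  note Z = Z_solids_D[OF assms(4-6)]
  let ?L = "{l' :: ('a ^ (4 + 4)) set. line l' \<and> l' \<subseteq> Sigma_first}"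
  have X: "\<X> = lifted_solid ` \<A>"
    using assms(3) by blast
  have cardX: "card \<X> = q^12"
    using assms(1,2) inj_lifted_solid unfolding X
    by (metis card_image inj_on_subset mrd_code_4_4_2_def subset_UNIV)
  have cardZl: "card (Z_solids \<P>' \<mu> l') = q^4 * (q^2 + 1)" if "l' \<in> ?L" for l'
    using card_Z_solids[OF assms(4-6)] that assms(1) by simp
  have "Z_solids \<P>' \<mu> l' \<inter> Z_solids \<P>' \<mu> m' = {}" if lm: "l' \<in> ?L" "m' \<in> ?L" "l' \<noteq> m'" for l' m'
  proof (rule ccontr)
    assume "Z_solids \<P>' \<mu> l' \<inter> Z_solids \<P>' \<mu> m' \<noteq> {}"
    then obtain W where "W \<in> Z_solids \<P>' \<mu> l'" "W \<in> Z_solids \<P>' \<mu> m'"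
      by blast
    \<comment> \<open>Both lines have the projection of the common solid \<open>W\<close>, and
      \<open>first_half\<close> is injective on \<open>Sigma_first\<close>.\<close>
    then have "first_half ` l' = first_half ` m'"
      using Z(3)[of l' W] Z(3)[of m' W] lm by simp
    moreover have "inj_on first_half (Sigma_first :: ('a ^ (4 + 4)) set)"
      by (simp add: inj_on_def first_half_inj_Sigma_first)
    ultimately show False
      using lm by (simp add: inj_on_image_eq_iff)
  qed
  then have "card \<Z> = (\<Sum>l'\<in>?L. card (Z_solids \<P>' \<mu> l'))"
    unfolding assms(7) by (intro card_UN_disjoint) auto
  also have "\<dots> = card ?L * (q^4 * (q^2 + 1))"
    using cardZl by simp
  \<comment> \<open>One factor q^2 + 1 counts the spread lines for a fixed \<open>l'\<close>; the
    other comes from the number (q^2 + q + 1)(q^2 + 1) of lines \<open>l'\<close>.\<close>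
  also have "\<dots> = q^4 * (q^2 + 1)^2 * (q^2 + q + 1)"
    using card_lines_one_parallelism[OF assms(5)] assms(1)
    by (simp only: power2_eq_square mult.assoc mult.commute mult.left_commute)
  finally have cardZ: "card \<Z> = q^4 * (q^2 + 1)^2 * (q^2 + q + 1)" .
  have dimX: "vec.dim (W \<inter> Sigma_last) = 0" if "W \<in> \<X>" for W
    using that lifted_solid_Int_Sigma_last unfolding X by force
  have dimZ: "vec.dim (W \<inter> Sigma_last) = 2" if "W \<in> \<Z>" for W
    using that Z(2) unfolding assms(7) by (auto simp: flat_def)
  have dimS: "vec.dim (Sigma_last \<inter> Sigma_last :: ('a ^ (4 + 4)) set) = 4"
    using solid_Sigma_last by (simp add: flat_def)
  have "\<X> \<inter> \<Z> = {}"
    using dimX dimZ by fastforce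
  moreover have "Sigma_last \<notin> \<X> \<union> \<Z>"
    using dimX[of Sigma_last] dimZ[of Sigma_last] unfolding dimS by auto
  ultimately have "card (\<X> \<union> \<Z> \<union> {Sigma_last}) = card \<X> + card \<Z> + 1"
    by (simp add: card_Un_disjoint)
  then have card: "card (\<X> \<union> \<Z> \<union> {Sigma_last}) = q^12 + q^4 * (q^2 + 1)^2 * (q^2 + q + 1) + 1"
    using cardX cardZ by simp
  have solids: "solid W" if "W \<in> \<X> \<union> \<Z> \<union> {Sigma_last}" for W
    using that Z(1) solid_lifted_solid solid_Sigma_last unfolding X assms(7) by blast
  have "\<exists>W\<in>\<X> \<union> \<Z> \<union> {Sigma_last}. V \<subseteq> W" if V: "flat 3 V" for V
  proof -
    have "vec.dim (V \<inter> Sigma_last) \<le> 3"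
      using V vec.dim_subset[of "V \<inter> Sigma_last" V] by (simp add: flat_def)
    \<comment> \<open>Trace dimension 0 calls for a lifted solid, 1 and 2 for a member of
      \<open>\<Z>\<close>, and 3 means that \<open>V\<close> lies in
      \<open>Sigma_last\<close>.\<close>
    then consider "vec.dim (V \<inter> Sigma_last) = 0" | "vec.dim (V \<inter> Sigma_last) = 1"
      | "vec.dim (V \<inter> Sigma_last) = 2" | "vec.dim (V \<inter> Sigma_last) = 3"
      by linarith
    then show ?thesis
    proof cases
      case 1
      then show ?thesis
        using mrd_code_covers[OF assms(2) V] X by blast
    next
      case 2
      then show ?thesis
        using Z_solids_cover_plane_meeting_in_point[OF assms(4-6) V] assms(7) by blast
    next
      case 3
      then show ?thesis
        using Z_solids_cover_plane_meeting_in_line[OF assms(4-6) V] assms(7) by blast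
    next
      case 4
      then have "V \<inter> Sigma_last = V"
        using V by (intro flat_subset_eq[of 3]) (auto simp: flat_def vec.subspace_inter)
      then show ?thesis
        by blast
    qed
  qed
  then have "q_covering_design 8 4 3 (\<X> \<union> \<Z> \<union> {Sigma_last})"
    using solids by (simp add: q_covering_design_def)
  then show ?thesis
    using cardX cardZl card by blast
qed

end
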